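(* Let $A$ be an integral domain with field of fractions $Q(A)$, let $p\in Q(A)$ be a plant and $\Theta\in Q(A)$ a signal generator. If $\Theta=\frac{\gamma}{\theta}$ is a weakly coprime factorization, then the robust regulation problem for $p$ with signal generator $\Theta$ is solvable if and only if the plant $p$ is stabilizable and there exist $\alpha,\beta\in A$ such that $\alpha\,\theta-\beta\,p=1$.
   Context: An integral domain is a commutative ring with unit $1$ and without zero divisors. A controller $c\in Q(A)$ stabilizes $p\in Q(A)$ if $1-pc\neq 0$ and $\frac{1}{1-pc},\ \frac{p}{1-pc},\ \frac{c}{1-pc}$ all belong to $A$. $\mathrm{Stab}(p)$ denotes the set of all stabilizing controllers of $p$; $p$ is stabilizable if $\mathrm{Stab}(p)\neq\emptyset$. A controller $c$ is robustly regulating (for $p$, with signal generator $\Theta$) if $c\in\mathrm{Stab}(p)$ and for every $p'\in\mathrm{Stab}(c)$ one has $\Theta\,\frac{1}{1-p'c}\in A$ and $\Theta\,\frac{p'}{1-p'c}\in A$. The robust regulation problem is the problem of finding a robustly regulating controller; it is solvable if such a controller exists. A fractional representation $\Theta=\frac{\gamma}{\theta}$ (with $0\neq\theta\in A$, $\gamma\in A$) is a weakly coprime factorization if for all $k\in Q(A)$: $k\gamma\in A$ and $k\theta\in A$ imply $k\in A$. *)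

theory Defs
  imports "HOL-Computational_Algebra.Polynomial_Factorial"
begin

text \<open>
  The integral domain \<open>A\<close> is the type \<open>'a :: idom\<close>, its field of fractions \<open>Q(A)\<close> is
  \<open>'a fract\<close>, and \<open>range to_fract\<close> is the copy of \<open>A\<close> inside \<open>Q(A)\<close>.
\<close>

abbreviation (input) in_ring :: "'a::idom fract \<Rightarrow> bool" where
  "in_ring x \<equiv> x \<in> range to_fract"

definition Stab :: "'a::idom fract \<Rightarrow> 'a fract set" where
  "Stab p = {c. 1 - p * c \<noteq> 0 \<and> in_ring (1 / (1 - p * c)) \<and>
                in_ring (p / (1 - p * c)) \<and> in_ring (c / (1 - p * c))}"

definition stabilizable :: "'a::idom fract \<Rightarrow> bool" where
  "stabilizable p \<longleftrightarrow> Stab p \<noteq> {}"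

definition robustly_regulating :: "'a::idom fract \<Rightarrow> 'a fract \<Rightarrow> 'a fract \<Rightarrow> bool" where
  "robustly_regulating p \<Theta> c \<longleftrightarrow> c \<in> Stab p \<and>
     (\<forall>p' \<in> Stab c. in_ring (\<Theta> * (1 / (1 - p' * c))) \<and> in_ring (\<Theta> * (p' / (1 - p' * c))))"

definition robust_regulation_solvable :: "'a::idom fract \<Rightarrow> 'a fract \<Rightarrow> bool" where
  "robust_regulation_solvable p \<Theta> \<longleftrightarrow> (\<exists>c. robustly_regulating p \<Theta> c)"

definition weakly_coprime_factorization :: "'a::idom fract \<Rightarrow> 'a \<Rightarrow> 'a \<Rightarrow> bool" where
  "weakly_coprime_factorization \<Theta> \<gamma> \<theta> \<longleftrightarrow> \<theta> \<noteq> 0 \<and> \<Theta> = Fract \<gamma> \<theta> \<and>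
     (\<forall>k. in_ring (k * to_fract \<gamma>) \<and> in_ring (k * to_fract \<theta>) \<longrightarrow> in_ring k)"

end

theory Submission
  imports Defs
begin

text \<open>
  Write \<open>A\<close> for the ring and \<open>Q\<close> for its field of fractions. A stabilizing controller \<open>c\<close> of \<open>p\<close>
  amounts to a pair \<open>U = 1 / (1 - p c)\<close>, \<open>V = c / (1 - p c)\<close> in \<open>A\<close> with \<open>U \<noteq> 0\<close>, \<open>p U \<in> A\<close> and
  \<open>U - p V = 1\<close>; the controller is recovered as \<open>c = V / U\<close> (lemma \<open>Stab_divide\<close>).

  If \<open>c\<close> is robustly regulating, then \<open>\<Theta> U \<in> A\<close>, because \<open>p\<close> itself stabilizes \<open>c\<close>. Weak
  coprimeness, applied to \<open>k = U / \<theta>\<close>, gives \<open>U = \<alpha> \<theta>\<close> with \<open>\<alpha> \<in> A\<close>, and then \<open>U - p V = 1\<close> is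
  the required identity, with \<open>\<beta> = V\<close>.

  Conversely, an internal model suffices: if \<open>c\<close> stabilizes \<open>p\<close> and \<open>\<Theta> = a + b c\<close> with
  \<open>a, b \<in> A\<close>, then \<open>c\<close> is robustly regulating (lemma \<open>internal_model_imp_robustly_regulating\<close>).
  Given \<open>\<alpha> \<theta> - \<beta> p = 1\<close> and a pair \<open>(U, V)\<close> as above, the pair \<open>U' = \<alpha> \<theta> U\<close>, \<open>V' = V + \<beta> U\<close>
  satisfies the same conditions whenever \<open>\<alpha> \<noteq> 0\<close>, and
  \<open>1 / \<theta> = \<alpha> U / U' = \<alpha> U (U' - p V') / U' = \<alpha> U - (\<alpha> p U) (V' / U')\<close>, so that
  \<open>c = V' / U'\<close> has the internal model property. If \<open>\<alpha> = 0\<close>, then \<open>\<beta> p = -1\<close>, and the identity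
  can be replaced by one with \<open>\<alpha> = -1\<close>.
\<close>

lemma in_ring_1: "in_ring (1 :: 'a::idom fract)"
  by (metis rangeI to_fract_1)

lemma in_ring_add: "in_ring x \<Longrightarrow> in_ring y \<Longrightarrow> in_ring (x + y)"
  by (auto simp flip: to_fract_add)

lemma in_ring_diff: "in_ring x \<Longrightarrow> in_ring y \<Longrightarrow> in_ring (x - y)"
  by (auto simp flip: to_fract_diff)

lemma in_ring_mult: "in_ring x \<Longrightarrow> in_ring y \<Longrightarrow> in_ring (x * y)"
  by (auto simp flip: to_fract_mult)

lemma in_ring_uminus: "in_ring x \<Longrightarrow> in_ring (- x)"
  by (auto simp flip: to_fract_uminus)

lemma Stab_sym: "c \<in> Stab p \<longleftrightarrow> p \<in> Stab c"
  by (auto simp: Stab_def mult.commute)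

lemma Stab_divide:
  assumes "in_ring U" "in_ring V" "in_ring (p * U)" "U \<noteq> 0" "U - p * V = 1"
  shows "V / U \<in> Stab p"
proof -
  have d: "1 - p * (V / U) = 1 / U"
    using assms(4,5) by (simp add: field_simps)
  show ?thesis
    unfolding Stab_def mem_Collect_eq d using assms by simp
qed

lemma StabE:
  assumes "c \<in> Stab p"
  obtains U V where "in_ring U" "in_ring V" "in_ring (p * U)" "U \<noteq> 0" "U - p * V = 1"
    "U = 1 / (1 - p * c)"
proof
  from assms have d: "1 - p * c \<noteq> 0" by (simp add: Stab_def)
  show "in_ring (1 / (1 - p * c))" "in_ring (c / (1 - p * c))" "in_ring (p * (1 / (1 - p * c)))"
    using assms by (simp_all add: Stab_def)
  show "1 / (1 - p * c) \<noteq> 0" using d by simp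
  have "1 / (1 - p * c) - p * (c / (1 - p * c)) = (1 - p * c) / (1 - p * c)"
    by (simp only: diff_divide_distrib times_divide_eq_right)
  with d show "1 / (1 - p * c) - p * (c / (1 - p * c)) = 1" by simp
qed simp

text \<open>
  The two signals to be regulated, \<open>\<Theta> / d\<close> and \<open>\<Theta> p' / d\<close> with \<open>d = 1 - p' c\<close>, are combinations
  over \<open>A\<close> of the entries \<open>1 / d\<close>, \<open>p' / d\<close>, \<open>c / d\<close> of the closed loop and of
  \<open>c p' / d = 1 / d - 1\<close>.
\<close>

lemma internal_model_imp_robustly_regulating:
  assumes c: "c \<in> Stab p" and "in_ring a" "in_ring b" and \<Theta>: "\<Theta> = a + b * c"
  shows "robustly_regulating p \<Theta> c"
  unfolding robustly_regulating_def
proof (intro conjI ballI)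
  fix p' assume "p' \<in> Stab c"
  then have p': "c \<in> Stab p'" by (simp add: Stab_sym)
  define d where "d = 1 - p' * c"
  from p' have "d \<noteq> 0" and rings: "in_ring (1 / d)" "in_ring (p' / d)" "in_ring (c / d)"
    by (auto simp: Stab_def d_def)
  have "\<Theta> * (1 / d) = a * (1 / d) + b * (c / d)"
    by (simp add: \<Theta> add_divide_distrib)
  then show "in_ring (\<Theta> * (1 / (1 - p' * c)))"
    unfolding d_def[symmetric] using assms(2,3) rings by (simp only: in_ring_add in_ring_mult)
  have "p' * c = 1 - d" by (simp add: d_def)
  then have "c * p' / d = 1 / d - 1"
    using \<open>d \<noteq> 0\<close> by (simp add: mult.commute diff_divide_distrib)
  moreover have "\<Theta> * (p' / d) = a * (p' / d) + b * (c * p' / d)"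
    by (simp add: \<Theta> distrib_right add_divide_distrib mult.assoc)
  ultimately have "\<Theta> * (p' / d) = a * (p' / d) + b * (1 / d - 1)" by simp
  then show "in_ring (\<Theta> * (p' / (1 - p' * c)))"
    unfolding d_def[symmetric] using assms(2,3) rings
    by (simp only: in_ring_add in_ring_mult in_ring_diff in_ring_1)
qed (rule c)

lemma Bezout_nonzero_coefficient:
  fixes p :: "'a::idom fract"
  assumes "to_fract \<alpha> * to_fract \<theta> - to_fract \<beta> * p = 1"
  obtains \<alpha>' \<beta>' where "\<alpha>' \<noteq> 0" "to_fract \<alpha>' * to_fract \<theta> - to_fract \<beta>' * p = 1"
proof (cases "\<alpha> = 0")
  case True
  with assms have "to_fract \<beta> * p = -1" by (simp add: minus_equation_iff)
  \<comment> \<open>The identity is preserved by adding \<open>\<beta> p\<close> to \<open>\<alpha>\<close> and \<open>\<beta> \<theta>\<close> to \<open>\<beta>\<close>.\<close>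
  moreover have "to_fract (\<beta> + \<beta> * \<theta>) * p = (1 + to_fract \<theta>) * (to_fract \<beta> * p)"
    by (simp add: algebra_simps)
  ultimately have "to_fract (-1) * to_fract \<theta> - to_fract (\<beta> + \<beta> * \<theta>) * p = 1"
    by simp
  then show thesis by (rule that[rotated]) simp
qed (use assms that in blast)

lemma stabilizable_Bezout_imp_solvable:
  fixes p :: "'a::idom fract"
  assumes "stabilizable p" and "\<theta> \<noteq> 0"
    and "to_fract \<alpha> * to_fract \<theta> - to_fract \<beta> * p = 1"
  shows "robust_regulation_solvable p (Fract \<gamma> \<theta>)"
proof -
  obtain \<alpha>' \<beta>' where "\<alpha>' \<noteq> 0" and "to_fract \<alpha>' * to_fract \<theta> - to_fract \<beta>' * p = 1"
    using Bezout_nonzero_coefficient[OF assms(3)] by blast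
  moreover define a t b g where "a = to_fract \<alpha>'" and "t = to_fract \<theta>" and "b = to_fract \<beta>'"
    and "g = to_fract \<gamma>"
  ultimately have bez: "a * t - b * p = 1" and "a \<noteq> 0" and "t \<noteq> 0"
    and abtg: "in_ring a" "in_ring b" "in_ring t" "in_ring g"
    using assms(2) by auto
  obtain c\<^sub>0 where "c\<^sub>0 \<in> Stab p"
    using assms(1) by (auto simp: stabilizable_def)
  then obtain U V where UV: "in_ring U" "in_ring V" "in_ring (p * U)" "U \<noteq> 0" "U - p * V = 1"
    by (rule StabE)
  define U' V' where "U' = a * t * U" and "V' = V + b * U"
  have "U' \<noteq> 0" using \<open>a \<noteq> 0\<close> \<open>t \<noteq> 0\<close> UV by (simp add: U'_def)
  have eq: "U' - p * V' = 1"
  proof -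
    have "U' - p * V' = (a * t - b * p) * U - p * V" by (simp add: U'_def V'_def algebra_simps)
    with bez UV(5) show ?thesis by simp
  qed
  have "in_ring U'" "in_ring V'"
    unfolding U'_def V'_def using abtg UV by (simp_all only: in_ring_add in_ring_mult)
  moreover have "p * U' = a * t * (p * U)" by (simp add: U'_def)
  then have "in_ring (p * U')" using abtg UV by (simp only: in_ring_mult)
  ultimately have "V' / U' \<in> Stab p"
    using \<open>U' \<noteq> 0\<close> eq by (intro Stab_divide)
  moreover have "in_ring (g * a * U)" "in_ring (- (g * a * (p * U)))"
    using abtg UV by (simp_all only: in_ring_mult in_ring_uminus)
  moreover have "Fract \<gamma> \<theta> = g * a * U + (- (g * a * (p * U))) * (V' / U')"
  proof -
    have "g * a * U + (- (g * a * (p * U))) * (V' / U') = g * a * U * (U' - p * V') / U'"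
      using \<open>U' \<noteq> 0\<close> by (simp add: field_simps)
    also have "\<dots> = g / t"
      unfolding eq using \<open>a \<noteq> 0\<close> \<open>t \<noteq> 0\<close> UV(4) by (simp add: U'_def field_simps)
    finally show ?thesis by (simp add: g_def t_def Fract_conv_to_fract)
  qed
  ultimately have "robustly_regulating p (Fract \<gamma> \<theta>) (V' / U')"
    by (rule internal_model_imp_robustly_regulating)
  then show ?thesis by (auto simp: robust_regulation_solvable_def)
qed

lemma robustly_regulating_imp_Bezout:
  assumes wcf: "weakly_coprime_factorization \<Theta> \<gamma> \<theta>" and "robustly_regulating p \<Theta> c"
  shows "\<exists>\<alpha> \<beta>. to_fract \<alpha> * to_fract \<theta> - to_fract \<beta> * p = 1"
proof -
  have c: "c \<in> Stab p" and "p \<in> Stab c"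
    using assms(2) by (auto simp: robustly_regulating_def Stab_sym)
  from c obtain U V where UV: "in_ring U" "in_ring V" "U - p * V = 1" "U = 1 / (1 - p * c)"
    by (rule StabE)
  have reg: "in_ring (\<Theta> * U)"
    using assms(2) \<open>p \<in> Stab c\<close> UV(4) by (auto simp: robustly_regulating_def)
  have "\<theta> \<noteq> 0" and \<Theta>: "\<Theta> = to_fract \<gamma> / to_fract \<theta>"
    using wcf by (auto simp: weakly_coprime_factorization_def Fract_conv_to_fract)
  define k where "k = U / to_fract \<theta>"
  have k\<theta>: "k * to_fract \<theta> = U" using \<open>\<theta> \<noteq> 0\<close> by (simp add: k_def)
  moreover have "k * to_fract \<gamma> = \<Theta> * U" by (simp add: k_def \<Theta>)
  ultimately have "in_ring k"
    using wcf reg UV(1) unfolding weakly_coprime_factorization_def by metis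
  with UV(2) obtain \<alpha> \<beta> where "k = to_fract \<alpha>" "V = to_fract \<beta>" by auto
  with k\<theta> UV(3) show ?thesis by (metis mult.commute)
qed

theorem theorem4p6:
  fixes p \<Theta> :: "'a::idom fract" and \<gamma> \<theta> :: 'a
  assumes "weakly_coprime_factorization \<Theta> \<gamma> \<theta>"
  shows "robust_regulation_solvable p \<Theta> \<longleftrightarrow>
    stabilizable p \<and> (\<exists>\<alpha> \<beta>. to_fract \<alpha> * to_fract \<theta> - to_fract \<beta> * p = 1)"
proof
  assume "robust_regulation_solvable p \<Theta>"
  then obtain c where c: "robustly_regulating p \<Theta> c"
    by (auto simp: robust_regulation_solvable_def)
  then have "stabilizable p"
    by (auto simp: robustly_regulating_def stabilizable_def)
  with robustly_regulating_imp_Bezout[OF assms c]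
  show "stabilizable p \<and> (\<exists>\<alpha> \<beta>. to_fract \<alpha> * to_fract \<theta> - to_fract \<beta> * p = 1)" by blast
next
  assume "stabilizable p \<and> (\<exists>\<alpha> \<beta>. to_fract \<alpha> * to_fract \<theta> - to_fract \<beta> * p = 1)"
  moreover have "\<theta> \<noteq> 0" "\<Theta> = Fract \<gamma> \<theta>"
    using assms by (auto simp: weakly_coprime_factorization_def)
  ultimately show "robust_regulation_solvable p \<Theta>"
    using stabilizable_Bezout_imp_solvable by blast
qed

end
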